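(* Let $\mathfrak S$ be a translative $G$-semimatroid of rank $d$. Then: (i) The $h$-polynomial of the simplicial poset $\mathcal I_{\mathfrak S}$ is $$h_{\mathcal I_{\mathfrak S}}(t)=t^d\,T_{\mathfrak S}(1/t,1),$$ and the characteristic polynomial of $\mathcal I_{\mathfrak S}$ is $$\chi_{\mathcal I_{\mathfrak S}}(t)=(-t)^d\,T_{\mathfrak S}\left(\frac{1-t}{t},1\right).$$ (ii) The characteristic polynomial of the poset $\mathcal P_{\mathfrak S}$ is $$\chi_{\mathcal P_{\mathfrak S}}(t)=(-1)^d\,T_{\mathfrak S}(1-t,0).$$
   Context: A simplicial complex on a (possibly infinite) set $S$ is a family of finite subsets of $S$ closed under taking subsets and containing all singletons. A semimatroid is a triple $\mathscr S=(S,\mathcal K,\rho)$ with $S$ a (possibly infinite) set, $\mathcal K$ a nonempty finite-dimensional simplicial complex on $S$ and $\rho:\mathcal K\to\mathbb N$ such that for all $X,Y\in\mathcal K$: (R1) $0\leq\rho(X)\leq|X|$; (R2) $X\subseteq Y$ implies $\rho(X)\leq\rho(Y)$; (R3) if $X\cup Y\in\mathcal K$ then $\rho(X)+\rho(Y)\geq\rho(X\cup Y)+\rho(X\cap Y)$; (CR1) if $\rho(X)=\rho(X\cap Y)$ then $X\cup Y\in\mathcal K$; (CR2) if $\rho(X)<\rho(Y)$ then $X\cup\{y\}\in\mathcal K$ for some $y\in Y\setminus X$. The rank is the maximum of $\rho$. The poset of independent sets is $\mathcal I(\mathscr S)=\{I\in\mathcal K\mid\rho(I)=|I|\}$ and the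 poset of flats is $\mathcal L(\mathscr S)=\{F\in\mathcal K\mid\rho(F')>\rho(F)\text{ for all }F'\in\mathcal K,\ F'\supsetneq F\}$, both ordered by inclusion. A $G$-semimatroid $\mathfrak S$ is an action of a group $G$ on a semimatroid $\mathscr S=(S,\mathcal K,\rho)$, i.e. an action by permutations of $S$ preserving $\mathcal K$ and $\rho$, with finitely many orbits on $\mathcal K$; its rank is the rank of $\mathscr S$. It is translative if for all $s\in S$, $g\in G$: $\{s,gs\}\in\mathcal K$ implies $gs=s$. The quotients $\mathcal K_{\mathfrak S}=\mathcal K/G$, $\mathcal I_{\mathfrak S}=\mathcal I(\mathscr S)/G$ and $\mathcal P_{\mathfrak S}=\mathcal L(\mathscr S)/G$ are the sets of orbits ordered by $Gx\leq Gy$ iff $gx\subseteq y$ for some $g\in G$. They are finite; $\mathcal I_{\mathfrak S}$ and $\mathcal P_{\mathfrak S}$ are bounded below and ranked of length $d$, the poset rank of an orbit being the value of $\rho$ on its elements. In the translative case $\mathcal I_{\mathfrak S}$ is a simplicial poset (it has a unique minimal element and all its lower intervals are Boolean algebras). Tutte polynomial. Let $E_{\mathfrak S}=S/G$ and $\operatorname{Supp}(G\{x_1,\dots,x_k\})=\{Gx_1,\dots,Gx_k\}$. For $A\subseteq E_{\mathfrak S}$ let $m_{\mathfrak S}(A)$ be the number of elements of $\mathcal K_{\mathfrak S}$ with support $A$ and, if $m_{\mathfrak S}(A)\neq0$, let $\underline\rho(A)=\rho(\alpha)$ for any $\alpha\in\mathcal K$ with $\operatorname{Supp}(G\alpha)=A$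 (well defined). Then $T_{\mathfrak S}(x,y)=\sum_{A\subseteq E_{\mathfrak S}}m_{\mathfrak S}(A)(x-1)^{d-\underline\rho(A)}(y-1)^{|A|-\underline\rho(A)}$. For a finite simplicial poset $P$ of length $d$ let $f_i(P)$ be the number of elements of rank $i+1$ (so $f_{-1}(P)=1$); its $h$-polynomial is $h_P(t)=t^d\sum_{i=0}^d f_{i-1}(P)\left(\frac{1-t}{t}\right)^{d-i}$. For a graded bounded-below poset $P$ of finite length $d$ with minimum $\hat0$ and rank function $\operatorname{rk}$, the characteristic polynomial is $\chi_P(t)=\sum_{x\in P}\mu_P(\hat0,x)t^{d-\operatorname{rk}(x)}$, with $\mu_P$ the Möbius function.
   Formalization: The characteristic polynomial of I in (i) is corrected to (-1)^d T(1-t,1), since the printed (-t)^d T((1-t)/t,1) fails for two parallel elements of rank 1; (ii) is stated for semimatroids without loops (no s with rho({s})=0), since with a loop T(x,0)=0 while chi_P is monic. *)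

theory Defs
  imports
    "HOL-Algebra.Group_Action"
    "HOL-Algebra.Order"
    "HOL-Computational_Algebra.Polynomial"
    "HOL-Computational_Algebra.Fraction_Field"
begin

section \<open>Semimatroids\<close>

locale simplicial_complex =
  fixes S :: "'s set" and K :: "'s set set"
  assumes faces: "X \<in> K \<Longrightarrow> finite X \<and> X \<subseteq> S"
    and down_closed: "\<lbrakk>X \<in> K; Y \<subseteq> X\<rbrakk> \<Longrightarrow> Y \<in> K"
    and singletons: "s \<in> S \<Longrightarrow> {s} \<in> K"

text \<open>The values of \<open>\<rho>\<close> outside \<open>K\<close> are irrelevant. The inequality \<open>0 \<le> \<rho> X\<close> of (R1) is
  contained in the type.\<close>

locale semimatroid = simplicial_complex S K
  for S :: "'s set" and K :: "'s set set" and \<rho> :: "'s set \<Rightarrow> nat" +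
  assumes nonempty: "K \<noteq> {}"
    and finite_dimensional: "\<exists>n. \<forall>X\<in>K. card X \<le> n"
    and R1: "X \<in> K \<Longrightarrow> \<rho> X \<le> card X"
    and R2: "\<lbrakk>X \<in> K; Y \<in> K; X \<subseteq> Y\<rbrakk> \<Longrightarrow> \<rho> X \<le> \<rho> Y"
    and R3: "\<lbrakk>X \<in> K; Y \<in> K; X \<union> Y \<in> K\<rbrakk> \<Longrightarrow> \<rho> X + \<rho> Y \<ge> \<rho> (X \<union> Y) + \<rho> (X \<inter> Y)"
    and CR1: "\<lbrakk>X \<in> K; Y \<in> K; \<rho> X = \<rho> (X \<inter> Y)\<rbrakk> \<Longrightarrow> X \<union> Y \<in> K"
    and CR2: "\<lbrakk>X \<in> K; Y \<in> K; \<rho> X < \<rho> Y\<rbrakk> \<Longrightarrow> \<exists>y\<in>Y - X. X \<union> {y} \<in> K"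

definition semimatroid_rank :: "'s set set \<Rightarrow> ('s set \<Rightarrow> nat) \<Rightarrow> nat" where
  "semimatroid_rank K \<rho> = Max (\<rho> ` K)"

definition indep_sets :: "'s set set \<Rightarrow> ('s set \<Rightarrow> nat) \<Rightarrow> 's set set" where
  "indep_sets K \<rho> = {I \<in> K. \<rho> I = card I}"

definition flats :: "'s set set \<Rightarrow> ('s set \<Rightarrow> nat) \<Rightarrow> 's set set" where
  "flats K \<rho> = {F \<in> K. \<forall>F'\<in>K. F \<subset> F' \<longrightarrow> \<rho> F' > \<rho> F}"

text \<open>Loops are allowed in a semimatroid. A translative action fixes every loop, so that
  \<open>T(x, y)\<close> is divisible by \<open>y\<close> if there is one and \<open>T(x, 0)\<close> vanishes, whereas the
  characteristic polynomial of the poset of flats is always monic.\<close>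

definition loopless :: "'s set \<Rightarrow> ('s set \<Rightarrow> nat) \<Rightarrow> bool" where
  "loopless S \<rho> \<longleftrightarrow> (\<forall>s\<in>S. \<rho> {s} \<noteq> 0)"


section \<open>Group actions on semimatroids\<close>

text \<open>The action \<open>\<phi>\<close> on \<open>S\<close> acts on subsets of \<open>S\<close> by taking images.\<close>

abbreviation set_action :: "('g \<Rightarrow> 's \<Rightarrow> 's) \<Rightarrow> 'g \<Rightarrow> 's set \<Rightarrow> 's set" where
  "set_action \<phi> \<equiv> \<lambda>g X. \<phi> g ` X"

locale G_semimatroid = semimatroid S K \<rho> + group_action G S \<phi>
  for G (structure) and S :: "'s set" and K :: "'s set set" and \<rho> :: "'s set \<Rightarrow> nat"
    and \<phi> :: "'g \<Rightarrow> 's \<Rightarrow> 's" +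
  assumes preserves_complex: "\<lbrakk>g \<in> carrier G; X \<in> K\<rbrakk> \<Longrightarrow> \<phi> g ` X \<in> K"
    and preserves_rank: "\<lbrakk>g \<in> carrier G; X \<in> K\<rbrakk> \<Longrightarrow> \<rho> (\<phi> g ` X) = \<rho> X"
    and finitely_many_orbits: "finite (orbits G K (set_action \<phi>))"

locale translative_G_semimatroid = G_semimatroid G S K \<rho> \<phi>
  for G (structure) and S :: "'s set" and K :: "'s set set" and \<rho> :: "'s set \<Rightarrow> nat"
    and \<phi> :: "'g \<Rightarrow> 's \<Rightarrow> 's" +
  assumes translative: "\<lbrakk>s \<in> S; g \<in> carrier G; {s, \<phi> g s} \<in> K\<rbrakk> \<Longrightarrow> \<phi> g s = s"

text \<open>For orbits, \<open>\<exists>X\<in>GX. \<exists>Y\<in>GY. X \<subseteq> Y\<close> says that some translate of a chosen representative of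
  \<open>GX\<close> is contained in a chosen representative of \<open>GY\<close>.\<close>

definition quotient_poset ::
    "('g, 'm) monoid_scheme \<Rightarrow> ('g \<Rightarrow> 's \<Rightarrow> 's) \<Rightarrow> 's set set \<Rightarrow> 's set set gorder" where
  "quotient_poset G \<phi> Q =
    \<lparr>carrier = orbits G Q (set_action \<phi>), eq = (=), le = (\<lambda>GX GY. \<exists>X\<in>GX. \<exists>Y\<in>GY. X \<subseteq> Y)\<rparr>"

definition indep_poset where
  "indep_poset G K \<rho> \<phi> = quotient_poset G \<phi> (indep_sets K \<rho>)"

definition flat_poset where
  "flat_poset G K \<rho> \<phi> = quotient_poset G \<phi> (flats K \<rho>)"


section \<open>The Tutte polynomial\<close>

text \<open>The support of an orbit of sets, computed from the union of all its members instead of from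
  a representative.\<close>

definition Supp ::
    "('g, 'm) monoid_scheme \<Rightarrow> ('g \<Rightarrow> 's \<Rightarrow> 's) \<Rightarrow> 's set set \<Rightarrow> 's set set" where
  "Supp G \<phi> \<X> = orbit G \<phi> ` \<Union>\<X>"

definition multiplicity_supp ::
    "('g, 'm) monoid_scheme \<Rightarrow> 's set set \<Rightarrow> ('g \<Rightarrow> 's \<Rightarrow> 's) \<Rightarrow> 's set set \<Rightarrow> nat" where
  "multiplicity_supp G K \<phi> A = card {\<X> \<in> orbits G K (set_action \<phi>). Supp G \<phi> \<X> = A}"

definition rank_supp ::
    "('g, 'm) monoid_scheme \<Rightarrow> 's set set \<Rightarrow> ('s set \<Rightarrow> nat) \<Rightarrow> ('g \<Rightarrow> 's \<Rightarrow> 's) \<Rightarrow> 's set set \<Rightarrow> nat"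
  where
  "rank_supp G K \<rho> \<phi> A = \<rho> (SOME \<alpha>. \<alpha> \<in> K \<and> Supp G \<phi> (orbit G (set_action \<phi>) \<alpha>) = A)"

text \<open>The polynomial is given by its value at elements \<open>x\<close>, \<open>y\<close> of an arbitrary commutative ring,
  in particular at indeterminates. The summands with \<open>multiplicity_supp G K \<phi> A = 0\<close> vanish, so
  the junk value of \<open>rank_supp\<close> there is harmless; in all other summands of a translative
  action the natural number subtractions are not truncated.\<close>

definition tutte ::
    "('g, 'm) monoid_scheme \<Rightarrow> 's set \<Rightarrow> 's set set \<Rightarrow> ('s set \<Rightarrow> nat) \<Rightarrow> ('g \<Rightarrow> 's \<Rightarrow> 's)
      \<Rightarrow> 'a::comm_ring_1 \<Rightarrow> 'a \<Rightarrow> 'a" where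
  "tutte G S K \<rho> \<phi> x y =
    (\<Sum>A\<in>Pow (orbits G S \<phi>). of_nat (multiplicity_supp G K \<phi> A)
        * (x - 1) ^ (semimatroid_rank K \<rho> - rank_supp G K \<rho> \<phi> A)
        * (y - 1) ^ (card A - rank_supp G K \<rho> \<phi> A))"


section \<open>Polynomials of finite posets\<close>

text \<open>The size of a longest chain strictly below \<open>x\<close>. In a graded poset with minimum this is
  the rank function.\<close>

definition poset_rank :: "('a, 'm) gorder_scheme \<Rightarrow> 'a \<Rightarrow> nat" where
  "poset_rank P x = Max {card C | C. C \<subseteq> {y \<in> carrier P. y \<sqsubset>\<^bsub>P\<^esub> x} \<and>
    (\<forall>y\<in>C. \<forall>z\<in>C. y \<sqsubseteq>\<^bsub>P\<^esub> z \<or> z \<sqsubseteq>\<^bsub>P\<^esub> y)}"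

definition poset_length :: "('a, 'm) gorder_scheme \<Rightarrow> nat" where
  "poset_length P = Max (poset_rank P ` carrier P)"

text \<open>The Moebius function \<open>\<mu>(x, y)\<close>, by recursion on \<open>y\<close> along the strict order, which is
  well-founded for finite \<open>P\<close>: \<open>\<mu>(x, x) = 1\<close> and
  \<open>\<mu>(x, y) = - (\<Sum>z with x \<le> z < y. \<mu>(x, z))\<close> for \<open>x < y\<close>.\<close>

definition moebius :: "('a, 'm) gorder_scheme \<Rightarrow> 'a \<Rightarrow> 'a \<Rightarrow> int" where
  "moebius P x = wfrec {(z, y). z \<in> carrier P \<and> y \<in> carrier P \<and> z \<sqsubset>\<^bsub>P\<^esub> y}
    (\<lambda>\<mu> y. if y = x then 1 else - (\<Sum>z | z \<in> carrier P \<and> x \<sqsubseteq>\<^bsub>P\<^esub> z \<and> z \<sqsubset>\<^bsub>P\<^esub> y. \<mu> z))"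

definition char_poly :: "('a, 'm) gorder_scheme \<Rightarrow> int poly" where
  "char_poly P =
    (\<Sum>x\<in>carrier P. monom (moebius P \<bottom>\<^bsub>P\<^esub> x) (poset_length P - poset_rank P x))"

text \<open>The index starts at \<open>-1\<close>: \<open>f_number P i\<close> counts the elements of rank \<open>i + 1\<close>.\<close>

definition f_number :: "('a, 'm) gorder_scheme \<Rightarrow> int \<Rightarrow> nat" where
  "f_number P i = card {x \<in> carrier P. int (poset_rank P x) = i + 1}"

text \<open>The indeterminate of the field of rational functions in one variable.\<close>

definition fract_X :: "int poly fract" where
  "fract_X = Fract [:0, 1:] 1"

text \<open>The defining formula divides by the indeterminate, so the h-polynomial is taken as an
  element of the field of rational functions.\<close>

definition h_poly :: "('a, 'm) gorder_scheme \<Rightarrow> int poly fract" where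
  "h_poly P = fract_X ^ poset_length P *
    (\<Sum>i=0..poset_length P. of_nat (f_number P (int i - 1))
        * ((1 - fract_X) / fract_X) ^ (poset_length P - i))"

end

theory Submission
  imports Defs
begin

text \<open>A translative action identifies no two distinct subsets of a face, so the elements of the
  quotient poset below the orbit of \<open>Y\<close> correspond to the members of the family contained in \<open>Y\<close>.
  For independent sets this interval is Boolean and the Moebius function is \<open>(- 1) ^ card I\<close>.
  For flats, sorting the subsets of \<open>F\<close> by their closures shows that \<open>\<mu>(\<bottom>, F)\<close> is the sum of
  \<open>(- 1) ^ card X\<close> over the sets \<open>X\<close> with closure \<open>F\<close>. On the other side, rank and cardinality
  of a face depend only on its support, so \<open>T(x, y)\<close> is a sum over the orbits of faces; at
  \<open>y = 1\<close> only the independent ones survive, and at \<open>y = 0\<close> it is grouped by closures.\<close>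

section \<open>Alternating sums and signs\<close>

text \<open>Multiplying out \<open>(- 1 + 1)\<close> once per element of \<open>Y\<close> gives one
  term per subset. This sum yields the Moebius recursion for both independent sets and
  flats.\<close>

lemma sum_Pow_minus_one_power:
  assumes "finite Y"
  shows "(\<Sum>X\<in>Pow Y. (- 1 :: 'a::comm_ring_1) ^ card X) = (if Y = {} then 1 else 0)"
proof -
  have "(\<Prod>y\<in>Y. (- 1 :: 'a) + 1) = (\<Sum>X\<in>Pow Y. (- 1) ^ card X)"
    using assms by (subst prod_add) simp_all
  then show ?thesis
    using assms by (cases "Y = {}") (simp_all add: power_0_left)
qed

text \<open>At \<open>x = 1 - t\<close> the factor \<open>x - 1\<close> is \<open>- t\<close>; the
  parities of \<open>d\<close> and \<open>d - r\<close> combine to that of \<open>r\<close>. This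
  turns a summand of the Tutte polynomial into one of a characteristic polynomial.\<close>

lemma minus_one_power_mult_monom:
  assumes "r \<le> d"
  shows "(- 1) ^ d * (- [:0, 1:]) ^ (d - r) = (monom ((- 1) ^ r) (d - r) :: 'a::comm_ring_1 poly)"
proof -
  have "(- [:0, 1:] :: 'a poly) ^ (d - r) = (- 1) ^ (d - r) * monom 1 (d - r)"
    by (subst power_minus) (simp add: monom_altdef)
  moreover have "(- 1 :: 'a poly) ^ d * (- 1) ^ (d - r) = (- 1) ^ r"
    using assms by (simp add: minus_one_power_iff)
  moreover have "(- 1 :: 'a poly) ^ r * monom 1 (d - r) = monom ((- 1) ^ r) (d - r)"
    by (simp add: minus_one_power_iff minus_monom)
  ultimately show ?thesis
    by (metis mult.assoc)
qed

section \<open>Closure in semimatroids\<close>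

context semimatroid
begin

lemma finite_face: "X \<in> K \<Longrightarrow> finite X"
  using faces by blast

lemma empty_face: "{} \<in> K"
  using nonempty down_closed by blast

lemma rank_empty: "\<rho> {} = 0"
  using R1[OF empty_face] by simp

lemma finite_ranks: "finite (\<rho> ` K)"
proof -
  obtain n where "\<forall>X\<in>K. card X \<le> n"
    using finite_dimensional by blast
  then have "\<rho> ` K \<subseteq> {..n}"
    using R1 order_trans by fastforce
  then show ?thesis
    by (rule finite_subset) simp
qed

lemma rank_le: "X \<in> K \<Longrightarrow> \<rho> X \<le> semimatroid_rank K \<rho>"
  unfolding semimatroid_rank_def using finite_ranks by simp

lemma rank_attained: "\<exists>X\<in>K. \<rho> X = semimatroid_rank K \<rho>"
proof -
  have "semimatroid_rank K \<rho> \<in> \<rho> ` K"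
    unfolding semimatroid_rank_def using finite_ranks nonempty by (intro Max_in) auto
  then show ?thesis
    by auto
qed

lemma rank_insert_le:
  assumes "insert s X \<in> K"
  shows "\<rho> (insert s X) \<le> Suc (\<rho> X)"
proof (cases "s \<in> X")
  case False
  have K: "X \<in> K" "{s} \<in> K"
    using assms down_closed by blast+
  have "\<rho> (X \<union> {s}) + \<rho> (X \<inter> {s}) \<le> \<rho> X + \<rho> {s}"
    using assms K by (intro R3) auto
  moreover have "\<rho> {s} \<le> 1"
    using R1[OF K(2)] by simp
  ultimately show ?thesis
    by simp
qed (simp add: insert_absorb)

text \<open>(R3) for \<open>J\<close> and its complement in \<open>I\<close>, whose ranks are
  bounded by their cardinalities, leaves no room for \<open>J\<close> to have smaller rank.\<close>

lemma indep_subset: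
  assumes "I \<in> indep_sets K \<rho>" "J \<subseteq> I"
  shows "J \<in> indep_sets K \<rho>"
proof -
  have I: "I \<in> K" "\<rho> I = card I"
    using assms(1) by (auto simp: indep_sets_def)
  have K: "J \<in> K" "I - J \<in> K"
    using I(1) assms(2) down_closed by blast+
  have "J \<union> (I - J) = I"
    using assms(2) by blast
  then have "\<rho> I + \<rho> (J \<inter> (I - J)) \<le> \<rho> J + \<rho> (I - J)"
    using R3[OF K] I(1) by simp
  moreover have "card I = card J + card (I - J)"
    using assms(2) finite_face[OF I(1)]
    by (metis card_Diff_subset card_mono finite_subset le_add_diff_inverse)
  ultimately have "card J \<le> \<rho> J"
    using I(2) R1[OF K(2)] by linarith
  then show ?thesis
    using K(1) R1[OF K(1)] by (simp add: indep_sets_def)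
qed

lemma basis_exists:
  assumes "X \<in> K"
  shows "\<exists>I\<in>indep_sets K \<rho>. I \<subseteq> X \<and> \<rho> I = \<rho> X"
  using finite_face[OF assms] assms
proof (induction X rule: finite_induct)
  case empty
  then show ?case
    by (simp add: indep_sets_def rank_empty)
next
  case (insert s X)
  have X: "X \<in> K"
    using insert.prems down_closed by blast
  then obtain I where I: "I \<in> K" "\<rho> I = card I" "I \<subseteq> X" "\<rho> I = \<rho> X"
    using insert.IH by (auto simp: indep_sets_def)
  have sI: "insert s I \<in> K"
    using insert.prems I(3) down_closed[of "insert s X" "insert s I"] by blast
  show ?case
  proof (cases "\<rho> (insert s X) = \<rho> X")
    case True
    then show ?thesis
      using I by (auto simp: indep_sets_def)
  next
    case False
    \<comment> \<open>With \<open>\<rho> I = \<rho> X\<close>, (R3) for \<open>X\<close> and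
      \<open>insert s I\<close> shows that adjoining \<open>s\<close> raises the rank of
      \<open>I\<close> at least as much as that of \<open>X\<close>.\<close>
    have un: "X \<union> insert s I = insert s X" "X \<inter> insert s I = I"
      using I(3) insert.hyps by auto
    have "\<rho> (insert s X) + \<rho> I \<le> \<rho> X + \<rho> (insert s I)"
      using R3[OF X sI] un insert.prems by simp
    moreover have "\<rho> X < \<rho> (insert s X)"
      using False R2[OF X insert.prems] by (simp add: subset_insertI)
    moreover have "card (insert s I) = Suc (card I)"
      using I insert.hyps finite_face by (intro card_insert_disjoint) auto
    ultimately have "\<rho> (insert s I) = card (insert s I)" "\<rho> (insert s I) = \<rho> (insert s X)"
      using R1[OF sI] I R2[OF sI insert.prems] rank_insert_le[OF insert.prems] by auto
    then show ?thesis
      using sI I(3) by (auto simp: indep_sets_def)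
  qed
qed

text \<open>\<open>Y \<inter> F\<close> lies between \<open>X\<close> and \<open>Y\<close>, so it
  has the rank of \<open>Y\<close>, and (CR1) makes \<open>Y \<union> F\<close> a face. By (R3) its
  rank does not exceed that of \<open>F\<close>, so the flat \<open>F\<close> cannot grow.\<close>

lemma flat_contains_same_rank:
  assumes "F \<in> flats K \<rho>" "X \<subseteq> F" "X \<subseteq> Y" "Y \<in> K" "\<rho> Y = \<rho> X"
  shows "Y \<subseteq> F"
proof -
  have F: "F \<in> K"
    using assms(1) by (simp add: flats_def)
  have K: "X \<in> K" "Y \<inter> F \<in> K"
    using assms(3,4) down_closed by blast+
  have eq: "\<rho> Y = \<rho> (Y \<inter> F)"
    using R2[OF K] R2[OF K(2) assms(4)] assms by auto
  then have un: "Y \<union> F \<in> K"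
    by (rule CR1[OF assms(4) F])
  have "\<rho> (Y \<union> F) \<le> \<rho> F"
    using R3[OF assms(4) F un] eq by simp
  then have "\<not> F \<subset> Y \<union> F"
    using assms(1) un by (auto simp: flats_def)
  then show ?thesis
    by blast
qed

text \<open>Finite dimension allows a face of largest cardinality among those containing
  \<open>X\<close> with the rank of \<open>X\<close>; any larger face must then have larger
  rank.\<close>

lemma spanned_flat_exists:
  assumes "X \<in> K"
  shows "\<exists>F\<in>flats K \<rho>. X \<subseteq> F \<and> \<rho> F = \<rho> X"
proof -
  obtain n where n: "\<forall>Y\<in>K. card Y \<le> n"
    using finite_dimensional by blast
  let ?Q = "\<lambda>Y. Y \<in> K \<and> X \<subseteq> Y \<and> \<rho> Y = \<rho> X"
  obtain F where F: "?Q F" and max: "\<And>Y. ?Q Y \<Longrightarrow> card Y \<le> card F"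
    using ex_has_greatest_nat[of ?Q X card "Suc n"] assms n by (auto simp: less_Suc_eq_le)
  have "\<rho> F < \<rho> F'" if "F' \<in> K" "F \<subset> F'" for F'
  proof (rule ccontr)
    assume "\<not> \<rho> F < \<rho> F'"
    then have "?Q F'"
      using that F R2[of F F'] by auto
    then show False
      using max[of F'] psubset_card_mono[OF finite_face[OF that(1)] that(2)] by simp
  qed
  then show ?thesis
    using F by (intro bexI[of _ F]) (simp_all add: flats_def)
qed

text \<open>For faces \<open>X\<close> the description is unique, since two such flats contain each
  other by \<open>flat_contains_same_rank\<close>. For other sets the value is unspecified.\<close>

definition closure :: "'s set \<Rightarrow> 's set" where
  "closure X = (THE F. F \<in> flats K \<rho> \<and> X \<subseteq> F \<and> \<rho> F = \<rho> X)"

lemma closure_eqI: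
  assumes "F \<in> flats K \<rho>" "X \<subseteq> F" "\<rho> F = \<rho> X"
  shows "closure X = F"
  unfolding closure_def
proof (rule the_equality)
  fix F' assume F': "F' \<in> flats K \<rho> \<and> X \<subseteq> F' \<and> \<rho> F' = \<rho> X"
  have "F' \<in> K" "F \<in> K"
    using F' assms(1) by (auto simp: flats_def)
  then show "F' = F"
    using flat_contains_same_rank[of F X F'] flat_contains_same_rank[of F' X F] F' assms by auto
qed (use assms in auto)

lemma
  assumes "X \<in> K"
  shows closure_flat: "closure X \<in> flats K \<rho>"
    and subset_closure: "X \<subseteq> closure X"
    and rank_closure: "\<rho> (closure X) = \<rho> X"
  using spanned_flat_exists[OF assms] closure_eqI[of _ X] by metis+

lemma closure_subset_flat:
  assumes "F \<in> flats K \<rho>" "X \<subseteq> F"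
  shows "closure X \<subseteq> F"
proof -
  have "X \<in> K"
    using assms down_closed by (auto simp: flats_def)
  then show ?thesis
    using flat_contains_same_rank[OF assms, of "closure X"] closure_flat[of X] subset_closure[of X]
      rank_closure[of X] by (auto simp: flats_def)
qed

text \<open>Remove a point from a basis of \<open>F\<close> and take the closure of what
  remains.\<close>

lemma flat_predecessor:
  assumes "F \<in> flats K \<rho>" "\<rho> F = Suc n"
  shows "\<exists>F'\<in>flats K \<rho>. F' \<subset> F \<and> \<rho> F' = n"
proof -
  have "F \<in> K"
    using assms(1) by (simp add: flats_def)
  then obtain I where I: "I \<in> indep_sets K \<rho>" "I \<subseteq> F" "\<rho> I = Suc n"
    using basis_exists assms(2) by metis
  then obtain s J where "I = insert s J" "s \<notin> J" "card J = n"
    using card_Suc_eq[of I n] by (auto simp: indep_sets_def)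
  then have J: "J \<subseteq> F" "J \<in> K" "\<rho> J = n"
    using I indep_subset[OF I(1), of J] by (auto simp: indep_sets_def)
  have "closure J \<subseteq> F"
    by (rule closure_subset_flat[OF assms(1) J(1)])
  moreover have "\<rho> (closure J) = n"
    using J rank_closure by simp
  ultimately show ?thesis
    using closure_flat[OF J(2)] assms(2) by (metis n_not_Suc_n psubsetI)
qed

end

section \<open>Orbits of faces\<close>

text \<open>Evaluation at a chosen representative; \<open>lift_orbit_orb\<close> removes the choice
  for invariant functions.\<close>

definition lift_orbit :: "('a \<Rightarrow> 'b) \<Rightarrow> 'a set \<Rightarrow> 'b" where
  "lift_orbit f \<X> = f (SOME X. X \<in> \<X>)"

context G_semimatroid
begin

abbreviation orb :: "'s set \<Rightarrow> 's set set" where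
  "orb \<equiv> orbit G (set_action \<phi>)"

definition invariant :: "('s set \<Rightarrow> 'b) \<Rightarrow> bool" where
  "invariant f \<longleftrightarrow> (\<forall>g\<in>carrier G. \<forall>X\<in>K. f (\<phi> g ` X) = f X)"

lemma group_G: "group G"
  using group_hom by (simp add: group_hom_def)

lemmas inv_closed = group.inv_closed[OF group_G]
  and m_closed = monoid.m_closed[OF group.is_monoid[OF group_G]]
  and one_closed = monoid.one_closed[OF group.is_monoid[OF group_G]]

lemma image_one: "X \<in> K \<Longrightarrow> \<phi> \<one> ` X = X"
  using faces[of X] by (force simp flip: id_eq_one)

lemma image_mult:
  assumes "X \<in> K" "g \<in> carrier G" "h \<in> carrier G"
  shows "\<phi> (g \<otimes> h) ` X = \<phi> g ` \<phi> h ` X"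
proof -
  have "X \<subseteq> S"
    using faces assms(1) by blast
  then show ?thesis
    unfolding image_image using assms(2,3) by (intro image_cong composition_rule) auto
qed

lemma image_inv:
  assumes "X \<in> K" "g \<in> carrier G"
  shows "\<phi> (inv g) ` \<phi> g ` X = X" "\<phi> g ` \<phi> (inv g) ` X = X"
  using assms group_G image_mult[OF assms(1) inv_closed, of g g] image_mult[OF assms(1), of g "inv g"]
  by (simp_all add: group.l_inv group.r_inv image_one inv_closed)

lemma inj_on_face: "X \<in> K \<Longrightarrow> g \<in> carrier G \<Longrightarrow> inj_on (\<phi> g) X"
  by (rule inj_on_subset[OF inj_prop]) (simp_all add: faces)

lemma card_image_face: "X \<in> K \<Longrightarrow> g \<in> carrier G \<Longrightarrow> card (\<phi> g ` X) = card X"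
  by (intro card_image inj_on_face)

lemma self_in_orb: "X \<in> K \<Longrightarrow> X \<in> orb X"
  unfolding orbit_def by (rule CollectI, rule exI[of _ \<one>]) (simp add: image_one one_closed)

lemma in_orbE:
  assumes "Y \<in> orb X"
  obtains g where "g \<in> carrier G" "Y = \<phi> g ` X"
  using assms by (auto simp: orbit_def)

lemma orb_image:
  assumes "X \<in> K" "g \<in> carrier G"
  shows "orb (\<phi> g ` X) = orb X"
proof -
  have "orb (\<phi> g ` X) \<subseteq> orb X" if "X \<in> K" "g \<in> carrier G" for X g
  proof
    fix Y assume "Y \<in> orb (\<phi> g ` X)"
    then obtain h where "h \<in> carrier G" "Y = \<phi> h ` \<phi> g ` X"
      by (rule in_orbE)
    then have "h \<in> carrier G" "Y = \<phi> (h \<otimes> g) ` X"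
      using that by (simp_all add: image_mult)
    then show "Y \<in> orb X"
      using that(2) m_closed by (auto simp: orbit_def)
  qed
  from this[OF assms] this[of "\<phi> g ` X" "inv g"] show ?thesis
    using assms by (simp add: image_inv preserves_complex inv_closed)
qed

lemma lift_orbit_orb:
  assumes "invariant f" "X \<in> K"
  shows "lift_orbit f (orb X) = f X"
proof -
  have "(SOME Y. Y \<in> orb X) \<in> orb X"
    using self_in_orb[OF assms(2)] by (rule someI[of "\<lambda>Y. Y \<in> orb X"])
  then obtain g where "g \<in> carrier G" "(SOME Y. Y \<in> orb X) = \<phi> g ` X"
    by (rule in_orbE)
  then show ?thesis
    using assms by (simp add: lift_orbit_def invariant_def)
qed

lemma invariant_rank: "invariant \<rho>"
  by (simp add: invariant_def preserves_rank)

lemma invariant_card: "invariant card"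
  by (simp add: invariant_def card_image_face)

lemmas lift_rank = lift_orbit_orb[OF invariant_rank]
  and lift_card = lift_orbit_orb[OF invariant_card]

lemma image_indep:
  assumes "I \<in> indep_sets K \<rho>" "g \<in> carrier G"
  shows "\<phi> g ` I \<in> indep_sets K \<rho>"
  using assms by (simp add: indep_sets_def preserves_complex preserves_rank card_image_face)

lemma image_flat:
  assumes "F \<in> flats K \<rho>" "g \<in> carrier G"
  shows "\<phi> g ` F \<in> flats K \<rho>"
proof -
  have F: "F \<in> K"
    using assms(1) by (simp add: flats_def)
  have g': "inv g \<in> carrier G"
    using assms(2) by (rule inv_closed)
  have "\<rho> (\<phi> g ` F) < \<rho> F'" if F': "F' \<in> K" "\<phi> g ` F \<subset> F'" for F'
  proof -
    have "F \<subseteq> \<phi> (inv g) ` F'"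
      using image_inv(1)[OF F assms(2)] F'(2) by blast
    moreover have "F \<noteq> \<phi> (inv g) ` F'"
      using image_inv(2)[OF F'(1) assms(2)] F'(2) by blast
    ultimately have "\<rho> F < \<rho> (\<phi> (inv g) ` F')"
      using assms(1) preserves_complex[OF g' F'(1)] by (auto simp: flats_def)
    then show ?thesis
      using F F'(1) assms(2) g' by (simp add: preserves_rank)
  qed
  then show ?thesis
    using F assms(2) by (simp add: flats_def preserves_complex)
qed

lemma closure_image:
  assumes "X \<in> K" "g \<in> carrier G"
  shows "closure (\<phi> g ` X) = \<phi> g ` closure X"
proof (rule closure_eqI)
  have "closure X \<in> K"
    using closure_flat[OF assms(1)] by (simp add: flats_def)
  then show "\<rho> (\<phi> g ` closure X) = \<rho> (\<phi> g ` X)"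
    using assms by (simp add: preserves_rank rank_closure)
  show "\<phi> g ` closure X \<in> flats K \<rho>"
    using assms by (intro image_flat closure_flat)
  show "\<phi> g ` X \<subseteq> \<phi> g ` closure X"
    using assms(1) by (intro image_mono subset_closure)
qed

text \<open>Allows orbits of faces to be sorted by the orbit of their closure, as the computation
  for flats requires.\<close>

lemma invariant_orb_closure: "invariant (\<lambda>X. orb (closure X))"
proof -
  have "closure X \<in> K" if "X \<in> K" for X
    using closure_flat[OF that] by (simp add: flats_def)
  then show ?thesis
    by (simp add: invariant_def closure_image orb_image)
qed

end

section \<open>Translativity, supports, and the Tutte polynomial as a sum over orbits of
  faces\<close>

context translative_G_semimatroid
begin

text \<open>A point of \<open>X\<close> and its translate both lie in \<open>Y\<close>, so they span
  a face and translativity makes them equal; \<open>X\<close> is even fixed pointwise.\<close>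

lemma translate_within_face:
  assumes "Y \<in> K" "X \<subseteq> Y" "g \<in> carrier G" "\<phi> g ` X \<subseteq> Y"
  shows "\<phi> g ` X = X"
proof -
  have "\<phi> g s = s" if "s \<in> X" for s
  proof (rule translative)
    show "s \<in> S"
      using that assms(1,2) faces by blast
    show "{s, \<phi> g s} \<in> K"
      using that assms by (intro down_closed[OF assms(1)]) auto
  qed (fact assms(3))
  then show ?thesis
    by simp
qed

lemma orb_inj_within_face:
  assumes "Y \<in> K" "X \<subseteq> Y" "X' \<subseteq> Y" "X' \<in> orb X"
  shows "X' = X"
  using assms translate_within_face by (metis in_orbE)

lemma inj_on_orb: "Y \<in> K \<Longrightarrow> inj_on orb (Pow Y)"
  by (rule inj_onI) (metis PowD orb_inj_within_face self_in_orb down_closed)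

lemma orbits_inj_on_face:
  assumes "X \<in> K"
  shows "inj_on (orbit G \<phi>) X"
proof (rule inj_onI)
  fix s t assume st: "s \<in> X" "t \<in> X" "orbit G \<phi> s = orbit G \<phi> t"
  have "s \<in> S" "t \<in> S"
    using st faces[OF assms] by auto
  then obtain g where g: "g \<in> carrier G" "t = \<phi> g s"
    using st(3) orbit_refl[of t] by (auto simp: orbit_def)
  have "{s, \<phi> g s} \<in> K"
    using st g by (intro down_closed[OF assms]) auto
  then show "s = t"
    using translative[OF \<open>s \<in> S\<close> g(1)] g(2) by simp
qed

text \<open>All translates of \<open>X\<close> meet the same point orbits, so the union over the
  whole orbit in \<open>Supp\<close> adds nothing to \<open>X\<close> itself.\<close>

lemma Supp_orb:
  assumes "X \<in> K"
  shows "Supp G \<phi> (orb X) = orbit G \<phi> ` X"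
proof -
  have "orbit G \<phi> (\<phi> g s) = orbit G \<phi> s" if "g \<in> carrier G" "s \<in> S" for g s
  proof -
    have "orbit G \<phi> (\<phi> g s) \<subseteq> orbit G \<phi> s" if "g \<in> carrier G" "s \<in> S" for g s
      unfolding orbit_def using that composition_rule[OF that(2) _ that(1)] m_closed
      by (auto simp: image_iff) metis
    from this[OF that] this[of "inv g" "\<phi> g s"] show ?thesis
      using that orbit_sym_aux[of g s] element_image[of g s] by (simp add: inv_closed)
  qed
  then have "orbit G \<phi> ` \<phi> g ` X = orbit G \<phi> ` X" if "g \<in> carrier G" for g
    unfolding image_image using faces[OF assms] that by (intro image_cong) auto
  then have "orbit G \<phi> ` Y = orbit G \<phi> ` X" if "Y \<in> orb X" for Y
    using that by (metis in_orbE)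
  then have "(\<Union>Y\<in>orb X. orbit G \<phi> ` Y) = (\<Union>Y\<in>orb X. orbit G \<phi> ` X)"
    by (rule SUP_cong[OF refl])
  moreover have "orb X \<noteq> {}"
    using self_in_orb[OF assms] by blast
  ultimately show ?thesis
    by (simp add: Supp_def image_Union)
qed

lemma card_Supp_orb: "X \<in> K \<Longrightarrow> card (Supp G \<phi> (orb X)) = card X"
  by (simp add: Supp_orb card_image orbits_inj_on_face)

text \<open>If \<open>\<rho> X < \<rho> Y\<close>, then (CR2) adjoins to \<open>X\<close> a point of \<open>Y - X\<close>, although \<open>X\<close> already
  meets the orbit of that point, which translativity forbids.\<close>

lemma rank_eq_if_same_support:
  assumes "X \<in> K" "Y \<in> K" "orbit G \<phi> ` X = orbit G \<phi> ` Y"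
  shows "\<rho> X = \<rho> Y"
proof -
  have "\<not> \<rho> X < \<rho> Y" if XY: "X \<in> K" "Y \<in> K" "orbit G \<phi> ` X = orbit G \<phi> ` Y" for X Y
  proof
    assume "\<rho> X < \<rho> Y"
    then obtain y where y: "y \<in> Y - X" "X \<union> {y} \<in> K"
      using CR2[OF XY(1,2)] by blast
    then obtain x where "x \<in> X" "orbit G \<phi> x = orbit G \<phi> y"
      using XY(3) by (metis DiffD1 image_iff)
    then have "x = y"
      using orbits_inj_on_face[OF y(2)] by (auto dest: inj_onD)
    then show False
      using y \<open>x \<in> X\<close> by simp
  qed
  then show ?thesis
    using assms by (metis linorder_neqE_nat)
qed

text \<open>The face picked by \<open>SOME\<close> in \<open>rank_supp\<close> may differ from
  \<open>X\<close> by more than a translation, but its support is the same, and that determines the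
  rank.\<close>

lemma rank_supp_Supp_orb:
  assumes "X \<in> K"
  shows "rank_supp G K \<rho> \<phi> (Supp G \<phi> (orb X)) = \<rho> X"
proof -
  define Y where "Y = (SOME \<alpha>. \<alpha> \<in> K \<and> Supp G \<phi> (orb \<alpha>) = Supp G \<phi> (orb X))"
  have "Y \<in> K \<and> Supp G \<phi> (orb Y) = Supp G \<phi> (orb X)"
    unfolding Y_def by (rule someI[of _ X]) (simp add: assms)
  then have "\<rho> Y = \<rho> X"
    using assms Supp_orb rank_eq_if_same_support[of Y X] by metis
  then show ?thesis
    by (simp add: rank_supp_def Y_def)
qed

text \<open>Every point orbit is in the support of the orbit of a singleton, and there are finitely
  many orbits of faces, each with finite support.\<close>

lemma finite_orbits_points: "finite (orbits G S \<phi>)"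
proof -
  have "finite (\<Union>\<X>\<in>orbits G K (set_action \<phi>). Supp G \<phi> \<X>)"
    using finitely_many_orbits finite_face by (auto simp: orbits_def Supp_orb)
  moreover have "orbits G S \<phi> \<subseteq> (\<Union>\<X>\<in>orbits G K (set_action \<phi>). Supp G \<phi> \<X>)"
    using singletons by (force simp: orbits_def Supp_orb)
  ultimately show ?thesis
    by (rule finite_subset[rotated])
qed

text \<open>Sort the orbits of faces by support. On each fibre rank and cardinality are constant,
  and \<open>multiplicity_supp\<close> is the size of the fibre; supports with empty fibre
  contribute 0 on both sides.\<close>

lemma tutte_eq_sum_orbits:
  "tutte G S K \<rho> \<phi> x y = (\<Sum>\<X>\<in>orbits G K (set_action \<phi>).
      (x - 1) ^ (semimatroid_rank K \<rho> - lift_orbit \<rho> \<X>)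
        * (y - 1) ^ (lift_orbit card \<X> - lift_orbit \<rho> \<X>))"
    (is "_ = sum ?f ?O")
proof -
  have "Supp G \<phi> ` ?O \<subseteq> Pow (orbits G S \<phi>)"
    using faces by (fastforce simp: orbits_def Supp_orb)
  then have "sum ?f ?O = (\<Sum>A\<in>Pow (orbits G S \<phi>). sum ?f {\<X> \<in> ?O. Supp G \<phi> \<X> = A})"
    using finitely_many_orbits finite_orbits_points by (intro sum.group[symmetric]) auto
  also have "\<dots> = tutte G S K \<rho> \<phi> x y"
    unfolding tutte_def
  proof (rule sum.cong[OF refl])
    fix A
    have "sum ?f {\<X> \<in> ?O. Supp G \<phi> \<X> = A} = (\<Sum>\<X> | \<X> \<in> ?O \<and> Supp G \<phi> \<X> = A.
      (x - 1) ^ (semimatroid_rank K \<rho> - rank_supp G K \<rho> \<phi> A)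
        * (y - 1) ^ (card A - rank_supp G K \<rho> \<phi> A))"
      by (rule sum.cong)
        (auto simp: orbits_def rank_supp_Supp_orb card_Supp_orb lift_rank lift_card)
    then show "sum ?f {\<X> \<in> ?O. Supp G \<phi> \<X> = A} = of_nat (multiplicity_supp G K \<phi> A)
        * (x - 1) ^ (semimatroid_rank K \<rho> - rank_supp G K \<rho> \<phi> A)
        * (y - 1) ^ (card A - rank_supp G K \<rho> \<phi> A)"
      by (simp add: multiplicity_supp_def mult.assoc)
  qed
  finally show ?thesis ..
qed

end

section \<open>Quotient posets of invariant families\<close>

text \<open>Covers both the independent sets and the flats; \<open>\<nu>\<close> is the candidate for the values
  \<open>\<mu>(\<bottom>, _)\<close> of the Moebius function.\<close>

locale ranked_invariant_family = translative_G_semimatroid G S K \<rho> \<phi>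
  for G (structure) and S :: "'s set" and K :: "'s set set" and \<rho> :: "'s set \<Rightarrow> nat"
    and \<phi> :: "'g \<Rightarrow> 's \<Rightarrow> 's" +
  fixes Q :: "'s set set" and \<nu> :: "'s set \<Rightarrow> int"
  assumes family_subset: "Q \<subseteq> K"
    and family_image: "\<lbrakk>g \<in> carrier G; X \<in> Q\<rbrakk> \<Longrightarrow> \<phi> g ` X \<in> Q"
    and family_empty: "{} \<in> Q"
    and family_strict: "\<lbrakk>X \<in> Q; Y \<in> Q; X \<subset> Y\<rbrakk> \<Longrightarrow> \<rho> X < \<rho> Y"
    and family_predecessor: "\<lbrakk>Y \<in> Q; \<rho> Y = Suc n\<rbrakk> \<Longrightarrow> \<exists>X\<in>Q. X \<subset> Y \<and> \<rho> X = n"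
    and family_rank: "\<exists>X\<in>Q. \<rho> X = semimatroid_rank K \<rho>"
    and sum_below: "Y \<in> Q \<Longrightarrow> (\<Sum>X | X \<in> Q \<and> X \<subseteq> Y. \<nu> X) = (if Y = {} then 1 else 0)"
begin

abbreviation (input) P where
  "P \<equiv> quotient_poset G \<phi> Q"

lemma in_family_face: "X \<in> Q \<Longrightarrow> X \<in> K"
  using family_subset by blast

lemma carrier_P: "carrier P = orb ` Q"
  by (auto simp: quotient_poset_def orbits_def)

lemma finite_carrier_P: "finite (carrier P)"
proof -
  have "carrier P \<subseteq> orbits G K (set_action \<phi>)"
    using family_subset by (auto simp: carrier_P orbits_def)
  then show ?thesis
    using finitely_many_orbits finite_subset by blast
qed

lemma le_orbE:
  assumes "X \<in> Q" "Y \<in> Q" "orb X \<sqsubseteq>\<^bsub>P\<^esub> orb Y"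
  obtains X' where "X' \<in> Q" "X' \<subseteq> Y" "orb X' = orb X"
proof -
  obtain g h where gh: "g \<in> carrier G" "h \<in> carrier G" "\<phi> g ` X \<subseteq> \<phi> h ` Y"
    using assms(3) by (auto simp: quotient_poset_def elim!: in_orbE)
  have h': "inv h \<in> carrier G"
    using gh(2) by (rule inv_closed)
  show thesis
  proof
    show "\<phi> (inv h) ` \<phi> g ` X \<in> Q"
      using assms gh h' by (intro family_image)
    show "\<phi> (inv h) ` \<phi> g ` X \<subseteq> Y"
      using gh(3) image_inv(1)[OF in_family_face[OF assms(2)] gh(2)] by blast
    show "orb (\<phi> (inv h) ` \<phi> g ` X) = orb X"
      using assms gh h' by (simp add: orb_image family_image in_family_face)
  qed
qed

lemma orb_le:
  assumes "X \<in> Q" "Y \<in> Q" "X \<subseteq> Y"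
  shows "orb X \<sqsubseteq>\<^bsub>P\<^esub> orb Y"
  using assms(3) self_in_orb[OF in_family_face[OF assms(1)]] self_in_orb[OF in_family_face[OF assms(2)]]
  by (auto simp: quotient_poset_def)

lemma orb_less_iff: "\<X> \<sqsubset>\<^bsub>P\<^esub> \<Y> \<longleftrightarrow> \<X> \<sqsubseteq>\<^bsub>P\<^esub> \<Y> \<and> \<X> \<noteq> \<Y>"
  by (simp add: lless_def quotient_poset_def)

text \<open>Any smaller orbit has a representative inside \<open>Y\<close>; strictness is preserved
  because \<open>orb\<close> is injective on the subsets of the face \<open>Y\<close>.\<close>

lemma strictly_below_orb:
  assumes "Y \<in> Q"
  shows "{\<X> \<in> carrier P. \<X> \<sqsubset>\<^bsub>P\<^esub> orb Y} = orb ` {X \<in> Q. X \<subset> Y}" (is "?L = ?R")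
proof
  show "?L \<subseteq> ?R"
  proof
    fix \<X> assume "\<X> \<in> ?L"
    then obtain X where X: "\<X> = orb X" "X \<in> Q" "orb X \<sqsubseteq>\<^bsub>P\<^esub> orb Y" "orb X \<noteq> orb Y"
      by (auto simp: carrier_P orb_less_iff)
    obtain X' where "X' \<in> Q" "X' \<subseteq> Y" "orb X' = orb X"
      using le_orbE[OF X(2) assms X(3)] .
    then show "\<X> \<in> ?R"
      using X by blast
  qed
  show "?R \<subseteq> ?L"
  proof
    fix \<X> assume "\<X> \<in> ?R"
    then obtain X where X: "\<X> = orb X" "X \<in> Q" "X \<subset> Y"
      by blast
    have "orb X \<noteq> orb Y"
      using X(3) inj_on_orb[OF in_family_face[OF assms]] by (auto dest: inj_onD)
    then show "\<X> \<in> ?L"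
      using X assms orb_le[of X Y] by (auto simp: carrier_P orb_less_iff)
  qed
qed

section \<open>Rank, length and minimum of the quotient poset\<close>

lemma lift_rank_less:
  assumes "\<X> \<in> carrier P" "\<Y> \<in> carrier P" "\<X> \<sqsubset>\<^bsub>P\<^esub> \<Y>"
  shows "lift_orbit \<rho> \<X> < lift_orbit \<rho> \<Y>"
proof -
  obtain Y where Y: "\<Y> = orb Y" "Y \<in> Q"
    using assms(2) by (auto simp: carrier_P)
  have "\<X> \<in> orb ` {X \<in> Q. X \<subset> Y}"
    using assms(1,3) unfolding Y(1) strictly_below_orb[OF Y(2), symmetric] by simp
  then obtain X where "\<X> = orb X" "X \<in> Q" "X \<subset> Y"
    by blast
  then show ?thesis
    using Y family_strict by (simp add: lift_rank in_family_face)
qed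

lemma bottom_P: "\<bottom>\<^bsub>P\<^esub> = orb {}"
  unfolding bottom_def
proof (rule some_equality)
  show "least P (orb {}) (carrier P)"
    using orb_le family_empty by (auto simp: least_def carrier_P)
next
  \<comment> \<open>Uniqueness is obtained without antisymmetry: a least element is below
    \<open>orb {}\<close>, and nothing is strictly below \<open>orb {}\<close>.\<close>
  fix \<X> assume "least P \<X> (carrier P)"
  then have X: "\<X> \<in> carrier P" "\<X> \<sqsubseteq>\<^bsub>P\<^esub> orb {}"
    using family_empty by (auto simp: least_def carrier_P)
  then have "\<not> \<X> \<sqsubset>\<^bsub>P\<^esub> orb {}"
    using strictly_below_orb[OF family_empty] by blast
  then show "\<X> = orb {}"
    using X(2) by (simp add: orb_less_iff)
qed

lemma maximal_chain_exists:
  assumes "Y \<in> Q"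
  shows "\<exists>C \<subseteq> {X \<in> Q. X \<subset> Y}. (\<forall>X\<in>C. \<forall>Z\<in>C. X \<subseteq> Z \<or> Z \<subseteq> X) \<and> finite C \<and> card C = \<rho> Y"
  using assms
proof (induction "\<rho> Y" arbitrary: Y)
  case 0
  then show ?case
    by (intro exI[of _ "{}"]) auto
next
  case (Suc n)
  obtain X where X: "X \<in> Q" "X \<subset> Y" "\<rho> X = n"
    using family_predecessor[OF Suc.prems] Suc.hyps(2) by metis
  then obtain C where C: "C \<subseteq> {Z \<in> Q. Z \<subset> X}" "\<forall>Z\<in>C. \<forall>Z'\<in>C. Z \<subseteq> Z' \<or> Z' \<subseteq> Z"
      "finite C" "card C = n"
    using Suc.hyps(1)[of X] by auto
  have "X \<notin> C"
    using C(1) by blast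
  then have "insert X C \<subseteq> {Z \<in> Q. Z \<subset> Y} \<and> finite (insert X C) \<and> card (insert X C) = Suc n"
    using X(1,2) C(1,3,4) by force
  moreover have "\<forall>Z\<in>insert X C. \<forall>Z'\<in>insert X C. Z \<subseteq> Z' \<or> Z' \<subseteq> Z"
    using C(1,2) by blast
  ultimately show ?case
    using Suc.hyps(2) by metis
qed

text \<open>Along a chain strictly below \<open>orb Y\<close> the rank is injective with values less
  than \<open>\<rho> Y\<close>, which bounds its size. Equality is reached by the image under
  \<open>orb\<close> of a chain of subsets of \<open>Y\<close>.\<close>

lemma poset_rank_orb:
  assumes "Y \<in> Q"
  shows "poset_rank P (orb Y) = \<rho> Y"
proof -
  let ?D = "{\<X> \<in> carrier P. \<X> \<sqsubset>\<^bsub>P\<^esub> orb Y}"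
  let ?c = "\<lambda>C. C \<subseteq> ?D \<and> (\<forall>\<X>\<in>C. \<forall>\<Z>\<in>C. \<X> \<sqsubseteq>\<^bsub>P\<^esub> \<Z> \<or> \<Z> \<sqsubseteq>\<^bsub>P\<^esub> \<X>)"
  have upper: "card C \<le> \<rho> Y" if "?c C" for C
  proof -
    have "inj_on (lift_orbit \<rho>) C"
    proof (rule inj_onI, rule ccontr)
      fix \<X> \<Z> assume XZ: "\<X> \<in> C" "\<Z> \<in> C" "lift_orbit \<rho> \<X> = lift_orbit \<rho> \<Z>" "\<X> \<noteq> \<Z>"
      then have "\<X> \<sqsubset>\<^bsub>P\<^esub> \<Z> \<or> \<Z> \<sqsubset>\<^bsub>P\<^esub> \<X>" "\<X> \<in> carrier P" "\<Z> \<in> carrier P"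
        using that by (auto simp: orb_less_iff)
      then show False
        using lift_rank_less XZ(3) by fastforce
    qed
    moreover have "lift_orbit \<rho> ` C \<subseteq> {..<\<rho> Y}"
      using that lift_rank_less[of _ "orb Y"] assms in_family_face[OF assms]
      by (auto simp: lift_rank carrier_P)
    ultimately show ?thesis
      using card_inj_on_le[of "lift_orbit \<rho>" C "{..<\<rho> Y}"] by simp
  qed
  obtain C where C: "C \<subseteq> {X \<in> Q. X \<subset> Y}" "\<forall>X\<in>C. \<forall>Z\<in>C. X \<subseteq> Z \<or> Z \<subseteq> X" "card C = \<rho> Y"
    using maximal_chain_exists[OF assms] by blast
  have "inj_on orb C"
    using C(1) by (intro inj_on_subset[OF inj_on_orb[OF in_family_face[OF assms]]]) auto
  then have card: "card (orb ` C) = \<rho> Y"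
    using C(3) by (simp add: card_image)
  have chain: "?c (orb ` C)"
  proof
    show "orb ` C \<subseteq> ?D"
      unfolding strictly_below_orb[OF assms] using C(1) by (rule image_mono)
    have "orb X \<sqsubseteq>\<^bsub>P\<^esub> orb Z \<or> orb Z \<sqsubseteq>\<^bsub>P\<^esub> orb X" if "X \<in> C" "Z \<in> C" for X Z
      using that C(1,2) orb_le[of X Z] orb_le[of Z X] by blast
    then show "\<forall>\<X>\<in>orb ` C. \<forall>\<Z>\<in>orb ` C. \<X> \<sqsubseteq>\<^bsub>P\<^esub> \<Z> \<or> \<Z> \<sqsubseteq>\<^bsub>P\<^esub> \<X>"
      by simp
  qed
  have "\<rho> Y \<in> {card C | C. ?c C}"
    by (intro CollectI exI[of _ "orb ` C"] conjI[OF _ chain]) (rule card[symmetric])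
  moreover have "finite {card C | C. ?c C}"
    by (rule finite_subset[of _ "{..\<rho> Y}"]) (use upper in blast, simp)
  ultimately show ?thesis
    unfolding poset_rank_def using upper by (intro Max_eqI) auto
qed

lemma poset_rank_P: "\<X> \<in> carrier P \<Longrightarrow> poset_rank P \<X> = lift_orbit \<rho> \<X>"
  by (auto simp: carrier_P poset_rank_orb lift_rank in_family_face)

lemma poset_length_P: "poset_length P = semimatroid_rank K \<rho>"
proof -
  have "poset_rank P ` carrier P = \<rho> ` Q"
    unfolding carrier_P image_image by (intro image_cong) (simp_all add: poset_rank_orb)
  moreover have "finite (\<rho> ` Q)"
    using finite_ranks family_subset by (meson finite_subset image_mono)
  moreover have "semimatroid_rank K \<rho> \<in> \<rho> ` Q"
    using family_rank by force
  moreover have "r \<le> semimatroid_rank K \<rho>" if "r \<in> \<rho> ` Q" for r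
    using that rank_le in_family_face by blast
  ultimately show ?thesis
    unfolding poset_length_def by (simp add: Max_eqI)
qed

section \<open>Moebius function, characteristic polynomial and f-numbers\<close>

lemma wf_less: "wf {(\<Z>, \<Y>). \<Z> \<in> carrier P \<and> \<Y> \<in> carrier P \<and> \<Z> \<sqsubset>\<^bsub>P\<^esub> \<Y>}"
  by (rule wf_subset[OF wf_measure[of "lift_orbit \<rho>"]]) (auto intro: lift_rank_less)

lemma moebius_rec:
  assumes "\<Y> \<in> carrier P"
  shows "moebius P \<X> \<Y> = (if \<Y> = \<X> then 1
    else - (\<Sum>\<Z> | \<Z> \<in> carrier P \<and> \<X> \<sqsubseteq>\<^bsub>P\<^esub> \<Z> \<and> \<Z> \<sqsubset>\<^bsub>P\<^esub> \<Y>. moebius P \<X> \<Z>))"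
  unfolding moebius_def
  by (subst wfrec[OF wf_less]) (auto simp: cut_apply assms intro!: sum.cong)

text \<open>Splitting the term for \<open>Y\<close> off \<open>sum_below\<close> gives exactly the
  Moebius recursion, because the orbits strictly below \<open>orb Y\<close> correspond to the
  members of \<open>Q\<close> strictly inside \<open>Y\<close>.\<close>

lemma moebius_orb:
  assumes "Y \<in> Q"
  shows "moebius P (orb {}) (orb Y) = \<nu> Y"
  using assms
proof (induction "\<rho> Y" arbitrary: Y rule: less_induct)
  case less
  have Y: "Y \<in> K"
    using less.prems by (rule in_family_face)
  have finY: "finite {X. X \<in> Q \<and> X \<subset> Y}"
    using finite_face[OF Y] by (auto intro: finite_subset[of _ "Pow Y"])
  have "{X. X \<in> Q \<and> X \<subseteq> Y} = insert Y {X. X \<in> Q \<and> X \<subset> Y}"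
    using less.prems by auto
  then have sum: "\<nu> Y + (\<Sum>X | X \<in> Q \<and> X \<subset> Y. \<nu> X) = (if Y = {} then 1 else 0)"
    using sum_below[OF less.prems] finY by simp
  have "orb Y = orb {} \<longleftrightarrow> Y = {}"
    using inj_on_orb[OF Y] by (auto dest: inj_onD)
  moreover have "{\<Z>. \<Z> \<in> carrier P \<and> orb {} \<sqsubseteq>\<^bsub>P\<^esub> \<Z> \<and> \<Z> \<sqsubset>\<^bsub>P\<^esub> orb Y} = orb ` {X \<in> Q. X \<subset> Y}"
    using orb_le[OF family_empty] by (subst strictly_below_orb[OF less.prems, symmetric])
      (auto simp: carrier_P)
  moreover have "(\<Sum>\<Z>\<in>orb ` {X \<in> Q. X \<subset> Y}. moebius P (orb {}) \<Z>) = (\<Sum>X | X \<in> Q \<and> X \<subset> Y. \<nu> X)"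
  proof (subst sum.reindex)
    show "inj_on orb {X \<in> Q. X \<subset> Y}"
      by (rule inj_on_subset[OF inj_on_orb[OF Y]]) auto
    show "sum (moebius P (orb {}) \<circ> orb) {X \<in> Q. X \<subset> Y} = (\<Sum>X | X \<in> Q \<and> X \<subset> Y. \<nu> X)"
      using less.hyps less.prems family_strict by (intro sum.cong) auto
  qed
  ultimately show ?case
    using sum less.prems by (subst moebius_rec) (simp_all add: carrier_P split: if_splits)
qed

lemma some_in_orbit:
  assumes "\<X> \<in> carrier P"
  shows "(SOME X. X \<in> \<X>) \<in> Q" "orb (SOME X. X \<in> \<X>) = \<X>"
proof -
  obtain X where X: "X \<in> Q" "\<X> = orb X"
    using assms by (auto simp: carrier_P)
  then have "(SOME X. X \<in> \<X>) \<in> orb X"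
    using self_in_orb[OF in_family_face[OF X(1)]] by (metis someI)
  then show "(SOME X. X \<in> \<X>) \<in> Q" "orb (SOME X. X \<in> \<X>) = \<X>"
    using X family_image orb_image in_family_face by (metis in_orbE)+
qed

text \<open>Since \<open>moebius_orb\<close> applies to every representative, in particular to the
  one chosen by \<open>lift_orbit\<close>, invariance of \<open>\<nu>\<close> need not be shown
  separately.\<close>

lemma char_poly_P: "char_poly P =
    (\<Sum>\<X>\<in>orb ` Q. monom (lift_orbit \<nu> \<X>) (semimatroid_rank K \<rho> - lift_orbit \<rho> \<X>))"
proof -
  have "moebius P (orb {}) \<X> = lift_orbit \<nu> \<X>" if "\<X> \<in> orb ` Q" for \<X>
    using moebius_orb some_in_orbit[of \<X>] that by (metis carrier_P lift_orbit_def)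
  then show ?thesis
    unfolding char_poly_def bottom_P poset_length_P
    by (simp add: poset_rank_P carrier_P cong: sum.cong)
qed

text \<open>Sort the orbits by rank; the shifted index makes \<open>f_number P (int i - 1)\<close>
  the number of orbits of rank \<open>i\<close>.\<close>

lemma sum_f_numbers:
  fixes c :: "'b::comm_ring_1"
  shows "(\<Sum>i=0..poset_length P. of_nat (f_number P (int i - 1)) * c ^ (poset_length P - i))
    = (\<Sum>\<X>\<in>orb ` Q. c ^ (semimatroid_rank K \<rho> - lift_orbit \<rho> \<X>))"
    (is "_ = sum ?f _")
proof -
  have "lift_orbit \<rho> ` orb ` Q \<subseteq> {0..semimatroid_rank K \<rho>}"
    using rank_le by (auto simp: lift_rank in_family_face)
  then have "sum ?f (orb ` Q) = (\<Sum>i=0..semimatroid_rank K \<rho>.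
      sum ?f {\<X> \<in> orb ` Q. lift_orbit \<rho> \<X> = i})"
    using finite_carrier_P by (intro sum.group[symmetric]) (auto simp: carrier_P)
  also have "\<dots> = (\<Sum>i=0..semimatroid_rank K \<rho>.
      of_nat (f_number P (int i - 1)) * c ^ (semimatroid_rank K \<rho> - i))"
    by (auto simp: f_number_def poset_rank_P carrier_P cong: conj_cong intro!: sum.cong)
  finally show ?thesis
    by (simp add: poset_length_P)
qed

end

section \<open>Independent sets and flats\<close>

context translative_G_semimatroid
begin

lemma ranked_invariant_family_indep:
  "ranked_invariant_family G S K \<rho> \<phi> (indep_sets K \<rho>) (\<lambda>I. (- 1) ^ card I)"
proof
  show "indep_sets K \<rho> \<subseteq> K"
    by (auto simp: indep_sets_def)
  show "{} \<in> indep_sets K \<rho>"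
    by (simp add: indep_sets_def empty_face rank_empty)
  show "\<phi> g ` X \<in> indep_sets K \<rho>" if "g \<in> carrier G" "X \<in> indep_sets K \<rho>" for g X
    using that image_indep by blast
  show "\<rho> X < \<rho> Y" if "X \<in> indep_sets K \<rho>" "Y \<in> indep_sets K \<rho>" "X \<subset> Y" for X Y
    using that finite_face by (auto simp: indep_sets_def intro: psubset_card_mono)
  show "\<exists>X\<in>indep_sets K \<rho>. X \<subset> Y \<and> \<rho> X = n" if Y: "Y \<in> indep_sets K \<rho>" "\<rho> Y = Suc n" for Y n
  proof -
    obtain s X where "Y = insert s X" "s \<notin> X" "card X = n"
      using card_Suc_eq[of Y n] Y by (auto simp: indep_sets_def)
    then show ?thesis
      using indep_subset[OF Y(1), of X] by (intro bexI[of _ X]) (auto simp: indep_sets_def)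
  qed
  show "\<exists>X\<in>indep_sets K \<rho>. \<rho> X = semimatroid_rank K \<rho>"
    using rank_attained basis_exists by metis
  show "(\<Sum>X | X \<in> indep_sets K \<rho> \<and> X \<subseteq> Y. (- 1) ^ card X) = (if Y = {} then 1 else (0::int))"
    if "Y \<in> indep_sets K \<rho>" for Y
  proof -
    \<comment> \<open>The lower interval is Boolean, so the full alternating sum over subsets
      applies.\<close>
    have "{X. X \<in> indep_sets K \<rho> \<and> X \<subseteq> Y} = Pow Y"
      using that indep_subset by blast
    moreover have "finite Y"
      using that finite_face by (simp add: indep_sets_def)
    ultimately show ?thesis
      by (simp add: sum_Pow_minus_one_power)
  qed
qed

text \<open>By (R1) the inequality means equality. It is the condition for the truncated exponent
  \<open>card - \<rho>\<close> in the Tutte polynomial to vanish.\<close>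

lemma orb_indep_sets: "orb ` indep_sets K \<rho>
    = {\<X> \<in> orbits G K (set_action \<phi>). lift_orbit card \<X> \<le> lift_orbit \<rho> \<X>}"
proof -
  have "indep_sets K \<rho> = {I \<in> K. card I \<le> \<rho> I}"
    using R1 by (force simp: indep_sets_def)
  then show ?thesis
    by (auto simp: orbits_def lift_rank lift_card)
qed

text \<open>At \<open>y = 1\<close> the powers of \<open>y - 1\<close> are powers of 0, and only
  exponent 0 contributes.\<close>

lemma tutte_at_one: "tutte G S K \<rho> \<phi> x 1
    = (\<Sum>\<X>\<in>orb ` indep_sets K \<rho>. (x - 1) ^ (semimatroid_rank K \<rho> - lift_orbit \<rho> \<X>))"
  unfolding tutte_eq_sum_orbits orb_indep_sets using finitely_many_orbits
  by (auto simp: sum.inter_filter power_0_left intro!: sum.cong)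

text \<open>The argument \<open>1 - t\<close> makes \<open>x - 1\<close> equal to
  \<open>- t\<close>, so the two sums agree term by term, the sign being
  \<open>(- 1) ^ card I\<close> with \<open>card I = \<rho> I\<close>.\<close>

lemma char_poly_indep: "char_poly (indep_poset G K \<rho> \<phi>)
    = (- 1) ^ semimatroid_rank K \<rho> * tutte G S K \<rho> \<phi> (1 - [:0, 1:]) 1"
proof -
  interpret ranked_invariant_family G S K \<rho> \<phi> "indep_sets K \<rho>" "\<lambda>I. (- 1) ^ card I"
    by (rule ranked_invariant_family_indep)
  have inv: "invariant (\<lambda>I. (- 1 :: int) ^ card I)"
    by (simp add: invariant_def card_image_face)
  show ?thesis
    unfolding indep_poset_def char_poly_P tutte_at_one sum_distrib_left
  proof (rule sum.cong[OF refl])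
    fix \<X> assume "\<X> \<in> orb ` indep_sets K \<rho>"
    then obtain I where I: "I \<in> K" "\<rho> I = card I" "\<X> = orb I"
      by (auto simp: indep_sets_def)
    then show "monom (lift_orbit (\<lambda>I. (- 1 :: int) ^ card I) \<X>)
        (semimatroid_rank K \<rho> - lift_orbit \<rho> \<X>)
      = (- 1) ^ semimatroid_rank K \<rho>
        * (1 - [:0, 1:] - 1) ^ (semimatroid_rank K \<rho> - lift_orbit \<rho> \<X>)"
      using minus_one_power_mult_monom[OF rank_le[OF I(1)], where 'a = int]
      by (simp add: lift_rank lift_orbit_orb[OF inv I(1)])
  qed
qed

lemma h_poly_indep: "h_poly (indep_poset G K \<rho> \<phi>)
    = fract_X ^ semimatroid_rank K \<rho> * tutte G S K \<rho> \<phi> (1 / fract_X) 1"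
proof -
  interpret ranked_invariant_family G S K \<rho> \<phi> "indep_sets K \<rho>" "\<lambda>I. (- 1) ^ card I"
    by (rule ranked_invariant_family_indep)
  have "fract_X \<noteq> 0"
    by (simp add: fract_X_def Zero_fract_def eq_fract)
  \<comment> \<open>The base of the powers in \<open>h_poly\<close> is \<open>x - 1\<close> for
    \<open>x = 1 / t\<close>.\<close>
  then have "(1 - fract_X) / fract_X = 1 / fract_X - 1"
    by (simp add: diff_divide_distrib)
  then show ?thesis
    unfolding h_poly_def indep_poset_def sum_f_numbers tutte_at_one by (simp add: poset_length_P)
qed

section \<open>Flats and their spanning subsets\<close>

text \<open>Whitney's alternating sum for the Moebius number of a flat. The condition
  \<open>X \<subseteq> F\<close> keeps \<open>X\<close> among the faces, where
  \<open>closure\<close> is meaningful.\<close>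

definition spanning_sign_sum :: "'s set \<Rightarrow> int" where
  "spanning_sign_sum F = (\<Sum>X | X \<subseteq> F \<and> closure X = F. (- 1) ^ card X)"

lemma ranked_invariant_family_flats:
  assumes "loopless S \<rho>"
  shows "ranked_invariant_family G S K \<rho> \<phi> (flats K \<rho>) spanning_sign_sum"
proof
  show "flats K \<rho> \<subseteq> K"
    by (auto simp: flats_def)
  \<comment> \<open>Here looplessness enters: a loop would enlarge \<open>{}\<close> without raising
    its rank.\<close>
  show "{} \<in> flats K \<rho>"
  proof -
    have "0 < \<rho> F" if F: "F \<in> K" "{} \<subset> F" for F
    proof -
      obtain s where s: "s \<in> F" "s \<in> S"
        using F faces by blast
      then have "{s} \<in> K" "\<rho> {s} \<noteq> 0"
        using assms singletons by (auto simp: loopless_def)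
      then show ?thesis
        using R2[of "{s}" F] F(1) s by simp
    qed
    then show ?thesis
      by (auto simp: flats_def empty_face rank_empty)
  qed
  show "\<phi> g ` X \<in> flats K \<rho>" if "g \<in> carrier G" "X \<in> flats K \<rho>" for g X
    using that image_flat by blast
  show "\<rho> X < \<rho> Y" if "X \<in> flats K \<rho>" "Y \<in> flats K \<rho>" "X \<subset> Y" for X Y
    using that by (auto simp: flats_def)
  show "\<exists>X\<in>flats K \<rho>. X \<subset> Y \<and> \<rho> X = n" if "Y \<in> flats K \<rho>" "\<rho> Y = Suc n" for Y n
    using that by (rule flat_predecessor)
  show "\<exists>X\<in>flats K \<rho>. \<rho> X = semimatroid_rank K \<rho>"
    using rank_attained spanned_flat_exists by metis
  show "(\<Sum>F | F \<in> flats K \<rho> \<and> F \<subseteq> Y. spanning_sign_sum F) = (if Y = {} then 1 else 0)"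
    if Y: "Y \<in> flats K \<rho>" for Y
  proof -
    have YK: "Y \<in> K"
      using Y by (simp add: flats_def)
    have fin: "finite (Pow Y)"
      using finite_face[OF YK] by simp
    have "(\<Sum>F | F \<in> flats K \<rho> \<and> F \<subseteq> Y. spanning_sign_sum F)
        = (\<Sum>F | F \<in> flats K \<rho> \<and> F \<subseteq> Y. \<Sum>X | X \<in> Pow Y \<and> closure X = F. (- 1) ^ card X)"
      unfolding spanning_sign_sum_def using down_closed[OF YK] subset_closure
      by (intro sum.cong) auto
    \<comment> \<open>Every subset of \<open>Y\<close> has its closure among the flats inside
      \<open>Y\<close>, so it is counted exactly once.\<close>
    also have "\<dots> = (\<Sum>X\<in>Pow Y. (- 1) ^ card X)"
    proof (rule sum.group)
      show "finite {F. F \<in> flats K \<rho> \<and> F \<subseteq> Y}"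
        by (rule finite_subset[OF _ fin]) auto
      show "closure ` Pow Y \<subseteq> {F. F \<in> flats K \<rho> \<and> F \<subseteq> Y}"
        using down_closed[OF YK] closure_flat closure_subset_flat[OF Y] by auto
    qed (fact fin)
    finally show ?thesis
      using finite_face[OF YK] by (simp add: sum_Pow_minus_one_power)
  qed
qed

text \<open>If the closure of \<open>X\<close> is a translate of \<open>F\<close>, the element
  moving it onto \<open>F\<close> moves \<open>X\<close> to a set with closure \<open>F\<close>.
  This describes the fibres when orbits are sorted by closure.\<close>

lemma orbits_spanning_flat:
  assumes "F \<in> flats K \<rho>"
  shows "{\<X> \<in> orbits G K (set_action \<phi>). lift_orbit (\<lambda>X. orb (closure X)) \<X> = orb F}
    = orb ` {X. X \<subseteq> F \<and> closure X = F}" (is "?L = ?R")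
proof
  have F: "F \<in> K"
    using assms by (simp add: flats_def)
  show "?L \<subseteq> ?R"
  proof
    fix \<X> assume "\<X> \<in> ?L"
    then obtain X where X: "X \<in> K" "\<X> = orb X" "orb (closure X) = orb F"
      by (auto simp: orbits_def lift_orbit_orb[OF invariant_orb_closure])
    then obtain g where g: "g \<in> carrier G" "F = \<phi> g ` closure X"
      using self_in_orb[OF F] by (metis in_orbE)
    then have "closure (\<phi> g ` X) = F" "\<phi> g ` X \<subseteq> F" "orb (\<phi> g ` X) = \<X>"
      using X subset_closure by (auto simp: closure_image orb_image)
    then show "\<X> \<in> ?R"
      by blast
  qed
  show "?R \<subseteq> ?L"
    using down_closed[OF F]
    by (auto simp: orbits_def lift_orbit_orb[OF invariant_orb_closure])
qed

lemma char_poly_flats: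
  assumes "loopless S \<rho>"
  shows "char_poly (flat_poset G K \<rho> \<phi>)
    = (- 1) ^ semimatroid_rank K \<rho> * tutte G S K \<rho> \<phi> (1 - [:0, 1:]) 0"
proof -
  interpret ranked_invariant_family G S K \<rho> \<phi> "flats K \<rho>" spanning_sign_sum
    by (rule ranked_invariant_family_flats[OF assms])
  let ?d = "semimatroid_rank K \<rho>"
  let ?O = "orbits G K (set_action \<phi>)"
  let ?cl = "lift_orbit (\<lambda>X. orb (closure X))"
  let ?f = "\<lambda>\<X>. monom ((- 1) ^ lift_orbit card \<X>) (?d - lift_orbit \<rho> \<X>) :: int poly"
  have "(- 1) ^ ?d * tutte G S K \<rho> \<phi> (1 - [:0, 1:]) 0 = sum ?f ?O"
    unfolding tutte_eq_sum_orbits sum_distrib_left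
  proof (rule sum.cong[OF refl])
    fix \<X> assume "\<X> \<in> ?O"
    then obtain X where X: "X \<in> K" "\<X> = orb X"
      by (auto simp: orbits_def)
    \<comment> \<open>At \<open>y = 0\<close> the factor \<open>y - 1 = - 1\<close> changes the sign
      from the parity of the rank to that of the cardinality.\<close>
    have "monom ((- 1) ^ \<rho> X) (?d - \<rho> X) * (- 1 :: int poly) ^ (card X - \<rho> X)
        = monom ((- 1) ^ card X) (?d - \<rho> X)"
      using R1[OF X(1)] by (auto simp: minus_one_power_iff minus_monom)
    then have "(- 1) ^ ?d * ((- [:0, 1:]) ^ (?d - \<rho> X) * (- 1 :: int poly) ^ (card X - \<rho> X))
        = monom ((- 1) ^ card X) (?d - \<rho> X)"
      by (simp only: minus_one_power_mult_monom[OF rank_le[OF X(1)]] flip: mult.assoc)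
    then show "(- 1) ^ ?d * ((1 - [:0, 1:] - 1) ^ (?d - lift_orbit \<rho> \<X>)
        * (0 - 1) ^ (lift_orbit card \<X> - lift_orbit \<rho> \<X>)) = ?f \<X>"
      using X by (simp add: lift_rank lift_card)
  qed
  also have "\<dots> = (\<Sum>\<F>\<in>orb ` flats K \<rho>. sum ?f {\<X> \<in> ?O. ?cl \<X> = \<F>})"
  proof (rule sum.group[symmetric])
    show "?cl ` ?O \<subseteq> orb ` flats K \<rho>"
      using closure_flat by (auto simp: orbits_def lift_orbit_orb[OF invariant_orb_closure])
  qed (use finitely_many_orbits finite_carrier_P in \<open>simp_all add: carrier_P\<close>)
  also have "\<dots> = (\<Sum>\<F>\<in>orb ` flats K \<rho>.
      monom (lift_orbit spanning_sign_sum \<F>) (?d - lift_orbit \<rho> \<F>))"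
  proof (rule sum.cong[OF refl])
    fix \<F> assume "\<F> \<in> orb ` flats K \<rho>"
    \<comment> \<open>\<open>F\<close> is the representative chosen by \<open>lift_orbit\<close>, so
      the third property holds by definition.\<close>
    then obtain F where F: "F \<in> flats K \<rho>" "\<F> = orb F"
        "lift_orbit spanning_sign_sum \<F> = spanning_sign_sum F"
      using some_in_orbit[of \<F>] by (metis carrier_P lift_orbit_def)
    have FK: "F \<in> K"
      using F(1) by (rule in_family_face)
    have "sum ?f {\<X> \<in> ?O. ?cl \<X> = \<F>} = (\<Sum>X | X \<subseteq> F \<and> closure X = F. ?f (orb X))"
      unfolding F(2) orbits_spanning_flat[OF F(1)]
      by (rule sum.reindex_cong[OF inj_on_subset[OF inj_on_orb[OF FK]]]) auto
    \<comment> \<open>All \<open>X\<close> with closure \<open>F\<close> have the rank of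
      \<open>F\<close>, so they contribute to a single power of \<open>t\<close>.\<close>
    also have "\<dots> = (\<Sum>X | X \<subseteq> F \<and> closure X = F. monom ((- 1) ^ card X) (?d - \<rho> F))"
      using down_closed[OF FK] rank_closure
      by (intro sum.cong) (auto simp: lift_rank lift_card)
    also have "\<dots> = monom (spanning_sign_sum F) (?d - \<rho> F)"
      by (simp add: spanning_sign_sum_def monom_sum)
    finally show "sum ?f {\<X> \<in> ?O. ?cl \<X> = \<F>}
        = monom (lift_orbit spanning_sign_sum \<F>) (?d - lift_orbit \<rho> \<F>)"
      using F FK by (simp add: lift_rank)
  qed
  finally show ?thesis
    by (simp add: flat_poset_def char_poly_P)
qed

end

theorem lemma8p8:
  fixes G :: "('g, 'm) monoid_scheme"
    and S :: "'s set" and K :: "'s set set" and \<rho> :: "'s set \<Rightarrow> nat"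
    and \<phi> :: "'g \<Rightarrow> 's \<Rightarrow> 's" and d :: nat
  assumes "translative_G_semimatroid G S K \<rho> \<phi>"
    and "semimatroid_rank K \<rho> = d"
  shows "(h_poly (indep_poset G K \<rho> \<phi>) = fract_X ^ d * tutte G S K \<rho> \<phi> (1 / fract_X) 1
      \<and> char_poly (indep_poset G K \<rho> \<phi>) = (- 1) ^ d * tutte G S K \<rho> \<phi> (1 - [:0, 1:]) 1)
    \<and> (loopless S \<rho> \<longrightarrow>
      char_poly (flat_poset G K \<rho> \<phi>) = (- 1) ^ d * tutte G S K \<rho> \<phi> (1 - [:0, 1:]) 0)"
proof -
  interpret translative_G_semimatroid G S K \<rho> \<phi>
    by (rule assms(1))
  show ?thesis
    using h_poly_indep char_poly_indep char_poly_flats assms(2) by simp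
qed

end
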